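(* Let $N,d,r$ be positive integers, let $X$ be a set of $N$ points in $\mathbb{R}^d$, and let \[ t=\left\lceil \frac{N}{r}-\sqrt{\frac{(d+1)(r-1)N\ln(Nr)}{2}}\right\rceil-1 . \] Then there is a partition of $X$ into $r$ parts $A_1,\ldots,A_r$ such that for any set $C$ of at most $t$ points, we have \[ \bigcap_{j=1}^r\operatorname{conv}(A_j\setminus C)\neq\emptyset . \]
   Context: $\operatorname{conv}$ denotes convex hull. If $t<0$ there is no set $C$ of at most $t$ points and the condition is vacuous; parts of a partition are allowed to be empty. *)

theory Defs
  imports "HOL-Analysis.Analysis"
begin

end

theory Submission
  imports Defs "HOL-Probability.Hoeffding"
begin

text \<open>
  Colour each point of \<open>X\<close> with one of \<open>r\<close> colours, independently and uniformly at random;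
  a suitable colouring exists because the expected number of bad events is less than one.

  The key is a dual description of failure. If the convex hulls of the sets \<open>A\<^sub>j - C\<close>
  have no common point, then there are affine functions \<open>f\<^sub>1, \<dots>, f\<^sub>r\<close> with sum zero such that
  \<open>f\<^sub>j < 0\<close> on \<open>A\<^sub>j - C\<close> for every \<open>j\<close> (\<open>disjoint_compact_convex_separation\<close>). An affine
  function on \<open>\<real>\<^sup>d\<close> is written as \<open>x \<mapsto> v \<bullet> (x, 1)\<close>. Call the set of all pairs \<open>(x, j)\<close> with
  \<open>f\<^sub>j x \<ge> 0\<close> the pattern of the tuple. A point that hits the pattern, in the sense that its
  value \<open>f\<^sub>j x\<close> for its own colour \<open>j\<close> is nonnegative, must lie in \<open>C\<close>. Hence the colouring
  survives the removal of every set of at most \<open>t\<close> points as soon as every pattern is hit by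
  more than \<open>t\<close> points.

  Because \<open>f\<^sub>1 x + \<dots> + f\<^sub>r x = 0\<close>, each point hits a fixed pattern with probability at
  least \<open>1 / r\<close>. So at least \<open>N / r\<close> hits are expected, and by Hoeffding's bound fewer than
  \<open>N / r - \<delta>\<close> hits occur with probability less than \<open>exp (- 2 \<delta>\<^sup>2 / N)\<close>
  (\<open>few_assignments_with_few_hits\<close>).

  Infinitely many tuples produce only few patterns: the tuples form a vector space of dimension
  \<open>n = (d + 1) (r - 1)\<close>, so their patterns shatter no set of more than \<open>n\<close> pairs, and the
  Sauer--Shelah argument bounds the number of patterns by \<open>(N r)\<^sup>n + 1\<close>
  (\<open>card_zero_sum_patterns_le\<close>). The pattern of the zero tuple contains every pair and is hit by
  every point, which leaves at most \<open>(N r)\<^sup>n\<close> patterns to worry about. The deviation in the definition of \<open>t\<close>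
  is the \<open>\<delta>\<close> with \<open>exp (- 2 \<delta>\<^sup>2 / N) = (N r)\<^sup>-\<^sup>n\<close>, so the union bound gives a total
  strictly below one.
\<close>

section \<open>Separating convex sets without a common point\<close>

text \<open>
  Let \<open>x\<close> minimise the sum of the squared distances to the sets, let \<open>p j x\<close> be its projection
  to \<open>K j\<close> and \<open>w j = x - p j x\<close>. Minimality forces the \<open>w j\<close> to sum to zero, as for a
  centroid. The projection property says that \<open>z \<mapsto> w j \<bullet> (z - x) + (norm (w j))\<^sup>2\<close> is
  nonpositive on \<open>K j\<close>. These functions have the constant sum \<open>\<Sum>j\<in>J. (norm (w j))\<^sup>2\<close>, which is
  positive as \<open>x\<close> is not in all the sets; subtracting the average \<open>m\<close> of these squares from
  each of them gives sum zero and strict negativity at once.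
\<close>

lemma disjoint_compact_convex_separation:
  fixes K :: "'i \<Rightarrow> 'a::euclidean_space set"
  assumes J: "finite J" "J \<noteq> {}"
    and cpt: "\<And>j. j \<in> J \<Longrightarrow> compact (K j)"
    and cvx: "\<And>j. j \<in> J \<Longrightarrow> convex (K j)"
    and disj: "(\<Inter>j\<in>J. K j) = {}"
  shows "\<exists>v :: 'i \<Rightarrow> 'a \<times> real.
           (\<Sum>j\<in>J. v j) = 0 \<and> (\<forall>j\<in>J. \<forall>x\<in>K j. v j \<bullet> (x, 1) < 0)"
proof (cases "\<forall>j\<in>J. K j \<noteq> {}")
  case False
  \<comment> \<open>Constant functions suffice: only the one that belongs to an empty set is not negative.\<close>
  then obtain i where i: "i \<in> J" "K i = {}" by blast
  define v :: "'i \<Rightarrow> 'a \<times> real"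
    where "v = (\<lambda>j. (0, (if j = i then real (card J) else 0) - 1))"
  have "(\<Sum>j\<in>J. v j) = 0"
    using J i by (simp add: v_def prod_eq_iff fst_sum snd_sum sum_subtractf)
  moreover have "\<forall>j\<in>J. \<forall>x\<in>K j. v j \<bullet> (x, 1) < 0"
    using i by (auto simp: v_def)
  ultimately show ?thesis by blast
next
  case True
  then have ne: "\<And>j. j \<in> J \<Longrightarrow> K j \<noteq> {}" by blast
  have clo: "closed (K j)" if "j \<in> J" for j
    using cpt[OF that] by (rule compact_imp_closed)
  define n where "n = real (card J)"
  have n: "n > 0" using J by (simp add: n_def card_gt_0_iff)
  \<comment> \<open>A compact set on which to minimise \<open>g\<close>; being convex, it contains the average \<open>y\<close> below.\<close>
  define S where "S = convex hull (\<Union>j\<in>J. K j)"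
  define p where "p = (\<lambda>j. closest_point (K j))"
  define g where "g = (\<lambda>x. \<Sum>j\<in>J. (norm (x - p j x))\<^sup>2)"
  have pK: "p j x \<in> K j" if "j \<in> J" for j x
    unfolding p_def using closest_point_in_set[OF clo[OF that] ne[OF that]] .
  have pS: "p j x \<in> S" if "j \<in> J" for j x
    unfolding S_def using pK[OF that] that by (intro hull_inc) blast
  have "compact S"
    unfolding S_def using J cpt by (intro compact_convex_hull compact_UN) auto
  moreover have "S \<noteq> {}" using J pS by blast
  moreover have "continuous_on S g"
    unfolding g_def p_def
    by (intro continuous_intros continuous_on_closest_point cvx clo ne)
  ultimately obtain x where x: "x \<in> S" "\<And>y. y \<in> S \<Longrightarrow> g x \<le> g y"
    using continuous_attains_inf[of S g] by metis
  define w where "w = (\<lambda>j. x - p j x)"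
  define W where "W = (\<Sum>j\<in>J. w j)"
  \<comment> \<open>The average of the projections of \<open>x\<close>. It would beat \<open>x\<close> if \<open>W\<close> were nonzero.\<close>
  define y where "y = x - (1 / n) *\<^sub>R W"
  have "y = (\<Sum>j\<in>J. (1 / n) *\<^sub>R p j x)"
    using n by (simp add: y_def W_def w_def sum_subtractf scaleR_sum_right[symmetric]
        sum_constant_scaleR n_def algebra_simps)
  moreover have "(\<Sum>j\<in>J. (1 / n) *\<^sub>R p j x) \<in> S"
    using J n pS by (intro convex_sum) (auto simp: S_def n_def)
  ultimately have "g x \<le> g y" using x by simp
  also have "g y \<le> (\<Sum>j\<in>J. (norm (w j - (1 / n) *\<^sub>R W))\<^sup>2)"
    unfolding g_def
  proof (intro sum_mono power_mono norm_ge_zero)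
    fix j assume j: "j \<in> J"
    have "dist y (p j y) \<le> dist y (p j x)"
      unfolding p_def using closest_point_le[OF clo[OF j] pK[OF j]] by (simp add: p_def)
    then show "norm (y - p j y) \<le> norm (w j - (1 / n) *\<^sub>R W)"
      by (simp add: dist_norm y_def w_def algebra_simps)
  qed
  also have "\<dots> = (\<Sum>j\<in>J. (norm (w j))\<^sup>2 - (2 / n) * (w j \<bullet> W) + (norm W)\<^sup>2 / n\<^sup>2)"
    by (intro sum.cong refl)
       (simp only: power2_norm_eq_inner, simp add: inner_diff_left inner_diff_right inner_commute
          power2_eq_square)
  also have "\<dots> = g x - (2 / n) * (W \<bullet> W) + n * ((norm W)\<^sup>2 / n\<^sup>2)"
    by (simp only: sum.distrib sum_subtractf sum_distrib_left[symmetric] inner_sum_left[symmetric]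
        W_def[symmetric], simp add: g_def w_def n_def)
  also have "\<dots> = g x - (norm W)\<^sup>2 / n"
    using n by (simp add: dot_square_norm power2_eq_square field_simps)
  finally have "(norm W)\<^sup>2 / n \<le> 0" by simp
  then have W0: "W = 0" using n by (simp add: divide_le_0_iff)
  define m where "m = (\<Sum>j\<in>J. (norm (w j))\<^sup>2) / n"
  have "\<exists>j\<in>J. w j \<noteq> 0"
  proof (rule ccontr)
    assume "\<not> ?thesis"
    then have "x \<in> (\<Inter>j\<in>J. K j)" using pK by (metis INT_I eq_iff_diff_eq_0 w_def)
    with disj show False by blast
  qed
  then have m: "m > 0"
    unfolding m_def using n J by (auto intro!: divide_pos_pos sum_pos2)
  define v where "v = (\<lambda>j. (w j, (norm (w j))\<^sup>2 - w j \<bullet> x - m))"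
  have "(\<Sum>j\<in>J. v j) = 0"
    using W0 n by (simp add: v_def prod_eq_iff fst_sum snd_sum sum_subtractf m_def
        inner_sum_left[symmetric] W_def[symmetric] n_def[symmetric])
  moreover have "v j \<bullet> (z, 1) < 0" if j: "j \<in> J" and z: "z \<in> K j" for j z
  proof -
    have "(x - p j x) \<bullet> (z - p j x) \<le> 0"
      unfolding p_def using closest_point_dot[OF cvx[OF j] clo[OF j] z] .
    then have "w j \<bullet> z \<le> w j \<bullet> x - (norm (w j))\<^sup>2"
      by (simp add: w_def power2_norm_eq_inner inner_diff_left inner_diff_right inner_commute)
    then show ?thesis using m by (simp add: v_def)
  qed
  ultimately show ?thesis by blast
qed

section \<open>Counting the sign patterns of a function space\<close>

text \<open>Gaussian elimination, one equation at a time.\<close>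
lemma underdetermined_system_nontrivial_solution:
  fixes a :: "'e \<Rightarrow> 's \<Rightarrow> real"
  assumes "finite I" "finite S" "card I < card S"
  shows "\<exists>c. (\<exists>s\<in>S. c s \<noteq> 0) \<and> (\<forall>i\<in>I. (\<Sum>s\<in>S. c s * a i s) = 0)"
  using assms
proof (induction I arbitrary: S a rule: finite_induct)
  case empty
  then have "S \<noteq> {}" by auto
  then show ?case by (intro exI[of _ "\<lambda>_. 1"]) auto
next
  case (insert i I)
  show ?case
  proof (cases "\<forall>s\<in>S. a i s = 0")
    case True
    moreover have "card I < card S" using insert by simp
    ultimately show ?thesis using insert.IH[of S a] insert.prems by auto
  next
    case False
    then obtain s0 where s0: "s0 \<in> S" "a i s0 \<noteq> 0" by blast
    define S' where "S' = S - {s0}"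
    have S': "finite S'" "s0 \<notin> S'" "S = insert s0 S'" using s0 insert.prems by (auto simp: S'_def)
    have "card I < card S'" using insert S' by simp
    then obtain c where c: "\<exists>s\<in>S'. c s \<noteq> 0"
      "\<forall>k\<in>I. (\<Sum>s\<in>S'. c s * (a k s - a k s0 * a i s / a i s0)) = 0"
      using insert.IH[of S' "\<lambda>k s. a k s - a k s0 * a i s / a i s0"] S' by auto
    define q where "q = (\<Sum>s\<in>S'. c s * a i s) / a i s0"
    define c' where "c' = c(s0 := - q)"
    have sum_c': "(\<Sum>s\<in>S. c' s * a k s) = (\<Sum>s\<in>S'. c s * a k s) - q * a k s0" for k
    proof -
      have "(\<Sum>s\<in>S'. c' s * a k s) = (\<Sum>s\<in>S'. c s * a k s)"
        using S' by (intro sum.cong) (auto simp: c'_def)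
      then show ?thesis using S' by (simp add: c'_def)
    qed
    have "(\<Sum>s\<in>S. c' s * a k s) = 0" if "k \<in> I" for k
    proof -
      have "0 = (\<Sum>s\<in>S'. c s * a k s - (a k s0 / a i s0) * (c s * a i s))"
        using c that by (auto simp: algebra_simps)
      also have "\<dots> = (\<Sum>s\<in>S'. c s * a k s) - q * a k s0"
        by (simp only: sum_subtractf sum_distrib_left[symmetric] q_def) simp
      finally show ?thesis using sum_c' by simp
    qed
    moreover have "(\<Sum>s\<in>S. c' s * a i s) = 0"
      using sum_c'[of i] s0 by (simp add: q_def)
    moreover have "\<exists>s\<in>S. c' s \<noteq> 0" using c S' by (auto simp: c'_def)
    ultimately show ?thesis by blast
  qed
qed

definition shatters :: "'e set set \<Rightarrow> 'e set \<Rightarrow> bool"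
  where "shatters F S \<longleftrightarrow> (\<forall>T\<subseteq>S. \<exists>P\<in>F. P \<inter> S = T)"

text \<open>
  This is Pajor's form of the Sauer--Shelah lemma. For a point \<open>e\<close>, the system \<open>F\<close> splits into
  two systems on the other points: the traces \<open>F0\<close> and those traces \<open>F1\<close> that extend to \<open>F\<close> both
  with and without \<open>e\<close>. The cardinalities add up. What \<open>F0\<close> shatters is shattered by \<open>F\<close>, and what
  \<open>F1\<close> shatters is shattered by \<open>F\<close> even after inserting \<open>e\<close>; sets of the two kinds are distinct.
\<close>
lemma card_le_card_shattered:
  fixes E :: "'e set"
  assumes "finite E" "F \<subseteq> Pow E"
  shows "card F \<le> card {S. S \<subseteq> E \<and> shatters F S}"
  using assms
proof (induction E arbitrary: F rule: finite_induct)
  case empty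
  show ?case
  proof (cases "F = {}")
    case False
    with empty have "F = {{}}" by auto
    then have "{S. S \<subseteq> {} \<and> shatters F S} = {{}}" by (auto simp: shatters_def)
    then show ?thesis using \<open>F = {{}}\<close> by simp
  qed simp
next
  case (insert e E)
  define Sh :: "'e set set \<Rightarrow> 'e set \<Rightarrow> 'e set set" where "Sh = (\<lambda>F D. {S. S \<subseteq> D \<and> shatters F S})"
  define F0 where "F0 = (\<lambda>P. P - {e}) ` F"
  define F1 where "F1 = {P \<in> F. e \<notin> P \<and> insert e P \<in> F}"
  have sub: "F0 \<subseteq> Pow E" "F1 \<subseteq> Pow E"
    using insert.prems by (auto simp: F0_def F1_def)
  have finF: "finite F" using insert by (meson finite.insertI finite_Pow_iff finite_subset)
  have finSh: "finite (Sh G D)" if "finite D" for G D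
    unfolding Sh_def by (rule finite_subset[of _ "Pow D"]) (use that in auto)
  have "card F = card F0 + card F1"
  proof -
    \<comment> \<open>\<open>L\<close> keeps one member of \<open>F\<close> for each trace, namely the one without \<open>e\<close> if there are two.\<close>
    define L where "L = F - (insert e ` F1)"
    have "F = L \<union> insert e ` F1" by (auto simp: L_def F1_def)
    moreover have "card (L \<union> insert e ` F1) = card L + card (insert e ` F1)"
      using finF by (intro card_Un_disjoint) (auto simp: L_def F1_def)
    moreover have "card (insert e ` F1) = card F1"
      by (intro card_image inj_onI) (auto simp: F1_def)
    moreover have "card L = card F0"
    proof -
      have "inj_on (\<lambda>P. P - {e}) L"
      proof (rule inj_onI)
        fix P Q assume PQ: "P \<in> L" "Q \<in> L" "P - {e} = Q - {e}"
        have no: "False" if "A \<in> L" "B \<in> L" "A - {e} = B - {e}" "e \<in> A" "e \<notin> B" for A B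
        proof -
          have "A = insert e B" using that by auto
          then show False using that by (auto simp: L_def F1_def)
        qed
        have "e \<in> P \<longleftrightarrow> e \<in> Q" using no[of P Q] no[of Q P] PQ by auto
        then show "P = Q" using PQ by blast
      qed
      moreover have "(\<lambda>P. P - {e}) ` L = F0"
      proof
        show "F0 \<subseteq> (\<lambda>P. P - {e}) ` L"
        proof
          fix Q assume "Q \<in> F0"
          then obtain P where P: "P \<in> F" "Q = P - {e}" by (auto simp: F0_def)
          show "Q \<in> (\<lambda>P. P - {e}) ` L"
          proof (cases "P \<in> insert e ` F1")
            case True
            then obtain R where R: "R \<in> F1" "P = insert e R" by blast
            then have "R \<in> L" "Q = R - {e}" using P by (auto simp: L_def F1_def)
            then show ?thesis by blast
          qed (use P in \<open>auto simp: L_def\<close>)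
        qed
      qed (auto simp: L_def F0_def)
      ultimately show ?thesis using card_image[of "\<lambda>P. P - {e}" L] by simp
    qed
    ultimately show ?thesis by simp
  qed
  also have "\<dots> \<le> card (Sh F0 E) + card (Sh F1 E)"
    unfolding Sh_def using insert.IH sub by (intro add_mono) auto
  also have "card (Sh F1 E) = card (insert e ` Sh F1 E)"
    using insert.hyps by (intro card_image[symmetric] inj_onI) (auto simp: Sh_def)
  also have "card (Sh F0 E) + card (insert e ` Sh F1 E) = card (Sh F0 E \<union> insert e ` Sh F1 E)"
    using insert.hyps finSh by (intro card_Un_disjoint[symmetric]) (auto simp: Sh_def)
  also have "\<dots> \<le> card (Sh F (insert e E))"
  proof (rule card_mono)
    show "finite (Sh F (insert e E))" using insert.hyps finSh by simp
    have "S \<in> Sh F (insert e E)" if "S \<in> Sh F0 E" for S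
    proof -
      have S: "S \<subseteq> E" "e \<notin> S" "shatters F0 S" using that insert.hyps by (auto simp: Sh_def)
      have "\<exists>P\<in>F. P \<inter> S = T" if "T \<subseteq> S" for T
      proof -
        have "\<exists>Q\<in>F0. Q \<inter> S = T" using S(3) that unfolding shatters_def by blast
        then obtain P where "P \<in> F" "(P - {e}) \<inter> S = T"
          unfolding F0_def by blast
        then show ?thesis using S by blast
      qed
      then show ?thesis using S unfolding Sh_def shatters_def by blast
    qed
    moreover have "insert e S \<in> Sh F (insert e E)" if "S \<in> Sh F1 E" for S
    proof -
      have S: "S \<subseteq> E" "e \<notin> S" "shatters F1 S" using that insert.hyps by (auto simp: Sh_def)
      have "\<exists>P\<in>F. P \<inter> insert e S = T" if T: "T \<subseteq> insert e S" for T
      proof -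
        have "T - {e} \<subseteq> S" using T by blast
        then obtain P where P: "P \<in> F1" "P \<inter> S = T - {e}"
          using S(3) unfolding shatters_def by blast
        then have "P \<in> F" "insert e P \<in> F" "e \<notin> P" by (auto simp: F1_def)
        moreover have "insert e P \<inter> insert e S = T" if "e \<in> T" using P T that by auto
        moreover have "P \<inter> insert e S = T" if "e \<notin> T" using P T that \<open>e \<notin> P\<close> by auto
        ultimately show ?thesis by blast
      qed
      then show ?thesis using S unfolding Sh_def shatters_def by blast
    qed
    ultimately show "Sh F0 E \<union> insert e ` Sh F1 E \<subseteq> Sh F (insert e E)" by blast
  qed
  finally show ?case by (simp add: Sh_def)
qed

text \<open>Each nonempty set of this kind is the set of entries of a list of length \<open>n\<close>.\<close>
lemma card_small_subsets_le:
  assumes "finite E"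
  shows "card {S. S \<subseteq> E \<and> card S \<le> n} \<le> card E ^ n + 1"
proof -
  define L where "L = {xs. set xs \<subseteq> E \<and> length xs = n}"
  have finL: "finite L" unfolding L_def by (rule finite_lists_length_eq[OF assms])
  have "{S. S \<subseteq> E \<and> card S \<le> n} \<subseteq> insert {} (set ` L)"
  proof
    fix S assume "S \<in> {S. S \<subseteq> E \<and> card S \<le> n}"
    then have S: "S \<subseteq> E" "card S \<le> n" by auto
    show "S \<in> insert {} (set ` L)"
    proof (cases "S = {}")
      case False
      then obtain s where s: "s \<in> S" by blast
      obtain xs where xs: "set xs = S" "length xs = card S"
        using finite_distinct_list distinct_card S assms by (metis finite_subset)
      have "xs @ replicate (n - card S) s \<in> L" "set (xs @ replicate (n - card S) s) = S"
        using xs s S by (auto simp: L_def)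
      then show ?thesis by blast
    qed simp
  qed
  then have "card {S. S \<subseteq> E \<and> card S \<le> n} \<le> card (insert {} (set ` L))"
    using finL by (intro card_mono) auto
  also have "\<dots> \<le> card (set ` L) + 1" using finL by (simp add: card_insert_if)
  also have "\<dots> \<le> card L + 1" using finL by (simp add: card_image_le)
  also have "card L = card E ^ n" unfolding L_def by (rule card_lists_length_eq[OF assms])
  finally show ?thesis .
qed

text \<open>
  If \<open>card S > card I\<close>, there is a nontrivial linear relation \<open>\<Sum>s\<in>S. b s * f s = 0\<close> that
  holds for every \<open>f\<close> in the span of the \<open>\<phi> i\<close>, and after a change of sign some \<open>b s\<close> is negative.
  Then no \<open>f\<close> can be nonnegative exactly where \<open>b\<close> is: all terms would be nonnegative and
  one of them positive. So the sign patterns shatter only sets of at most \<open>card I\<close> points.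
\<close>
lemma card_sign_patterns_le:
  fixes \<phi> :: "'i \<Rightarrow> 'e \<Rightarrow> real"
  assumes E: "finite E" and I: "finite I"
  shows "card (range (\<lambda>w. {e\<in>E. 0 \<le> (\<Sum>i\<in>I. w i * \<phi> i e)})) \<le> card E ^ card I + 1"
proof -
  define F where "F = range (\<lambda>w. {e\<in>E. 0 \<le> (\<Sum>i\<in>I. w i * \<phi> i e)})"
  have "card S \<le> card I" if S: "S \<subseteq> E" "shatters F S" for S
  proof (rule ccontr)
    assume "\<not> card S \<le> card I"
    moreover have finS: "finite S" using S E finite_subset by blast
    ultimately obtain c where c: "\<exists>s\<in>S. c s \<noteq> 0"
      and c0: "\<And>i. i \<in> I \<Longrightarrow> (\<Sum>s\<in>S. c s * \<phi> i s) = 0"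
      using underdetermined_system_nontrivial_solution[OF I finS, of \<phi>] by auto
    have no: False if neg: "s0 \<in> S" "b s0 < 0" and b0: "\<And>i. i \<in> I \<Longrightarrow> (\<Sum>s\<in>S. b s * \<phi> i s) = 0"
      for b :: "'e \<Rightarrow> real" and s0
    proof -
      obtain w where w: "{e\<in>E. 0 \<le> (\<Sum>i\<in>I. w i * \<phi> i e)} \<inter> S = {s\<in>S. 0 \<le> b s}"
        using S unfolding shatters_def F_def by (metis (no_types, lifting) imageE mem_Collect_eq subsetI)
      define f where "f = (\<lambda>e. \<Sum>i\<in>I. w i * \<phi> i e)"
      have sgn: "0 \<le> f s \<longleftrightarrow> 0 \<le> b s" if "s \<in> S" for s
        using w that S unfolding f_def by blast
      have "(\<Sum>s\<in>S. b s * f s) = (\<Sum>i\<in>I. w i * (\<Sum>s\<in>S. b s * \<phi> i s))"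
        unfolding f_def sum_distrib_left
        by (subst sum.swap) (simp add: mult_ac)
      also have "\<dots> = 0" using b0 by simp
      finally have "(\<Sum>s\<in>S. b s * f s) = 0" .
      moreover have "(\<Sum>s\<in>S. b s * f s) > 0"
      proof (rule sum_pos2[OF finS \<open>s0 \<in> S\<close>])
        show "0 < b s0 * f s0" using sgn[of s0] neg by (auto intro: mult_neg_neg)
        show "0 \<le> b s * f s" if "s \<in> S" for s using sgn[OF that]
          by (cases "0 \<le> b s") (auto intro: mult_nonpos_nonpos)
      qed
      ultimately show False by simp
    qed
    obtain s0 where s0: "s0 \<in> S" "c s0 \<noteq> 0" using c by blast
    show False
    proof (cases "c s0 < 0")
      case True
      then show False using no[of s0 c] s0 c0 by blast
    next
      case False
      then show False using no[of s0 "\<lambda>s. - c s"] s0 c0 by (simp add: sum_negf)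
    qed
  qed
  then have "{S. S \<subseteq> E \<and> shatters F S} \<subseteq> {S. S \<subseteq> E \<and> card S \<le> card I}" by blast
  then have "card {S. S \<subseteq> E \<and> shatters F S} \<le> card {S. S \<subseteq> E \<and> card S \<le> card I}"
    using E by (intro card_mono) auto
  moreover have "card F \<le> card {S. S \<subseteq> E \<and> shatters F S}"
    using E by (intro card_le_card_shattered) (auto simp: F_def)
  ultimately show ?thesis using card_small_subsets_le[OF E, of "card I"] by (simp add: F_def)
qed

text \<open>
  The tuples \<open>v\<close> with sum zero are parametrised by the coordinates of all entries but one, so the
  functions \<open>(x, j) \<mapsto> v j \<bullet> h x\<close> form a space of dimension at most \<open>DIM('b) * (card J - 1)\<close>.
\<close>
lemma card_zero_sum_patterns_le:
  fixes h :: "'x \<Rightarrow> 'b::euclidean_space" and J :: "'j set"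
  assumes X: "finite X" and J: "finite J" "J \<noteq> {}"
  shows "finite {{(x, j) \<in> X \<times> J. 0 \<le> v j \<bullet> h x} | v. (\<Sum>j\<in>J. v j) = 0}" (is "finite ?F")
    and "card {{(x, j) \<in> X \<times> J. 0 \<le> v j \<bullet> h x} | v. (\<Sum>j\<in>J. v j) = 0}
           \<le> (card X * card J) ^ (DIM('b) * (card J - 1)) + 1"
proof -
  obtain k where k: "k \<in> J" using J by blast
  \<comment> \<open>The entry \<open>v k\<close> is determined by the other ones as minus their sum.\<close>
  define I where "I = (J - {k}) \<times> (Basis :: 'b set)"
  define \<phi> where "\<phi> = (\<lambda>(i, b) (x, j). 
      (if j = k then - (h x \<bullet> b) else if j = i then h x \<bullet> b else 0))"
  let ?S = "range (\<lambda>w. {e \<in> X \<times> J. 0 \<le> (\<Sum>i\<in>I. w i * \<phi> i e)})"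
  have fin: "finite (X \<times> J)" "finite I" using X J by (auto simp: I_def)
  have finS: "finite ?S" using fin by (intro finite_subset[of ?S "Pow (X \<times> J)"]) auto
  have sub: "?F \<subseteq> ?S"
  proof
    fix P assume "P \<in> ?F"
    then obtain v where P: "P = {(x, j) \<in> X \<times> J. 0 \<le> v j \<bullet> h x}" and v: "(\<Sum>j\<in>J. v j) = 0"
      by blast
    define w where "w = (\<lambda>(i, b). v i \<bullet> b)"
    have vk: "v k = - (\<Sum>i\<in>J - {k}. v i)"
      using v J k by (simp add: sum.remove[of J k] eq_neg_iff_add_eq_0)
    have eq: "(\<Sum>i\<in>I. w i * \<phi> i (x, j)) = v j \<bullet> h x" if j: "j \<in> J" for x j
    proof -
      have "(\<Sum>i\<in>I. w i * \<phi> i (x, j)) = (\<Sum>i\<in>J - {k}. \<Sum>b\<in>Basis. w (i, b) * \<phi> (i, b) (x, j))"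
        unfolding I_def by (simp add: sum.cartesian_product)
      also have "\<dots> = v j \<bullet> h x"
      proof (cases "j = k")
        case True
        have "(\<Sum>b\<in>Basis. w (i, b) * \<phi> (i, b) (x, j)) = - (v i \<bullet> h x)" for i
          using True by (simp add: w_def \<phi>_def sum_negf euclidean_inner[of "v i" "h x"])
        then show ?thesis using True by (simp add: vk sum_negf inner_sum_left)
      next
        case False
        have "(\<Sum>b\<in>Basis. w (i, b) * \<phi> (i, b) (x, j)) = (if i = j then v j \<bullet> h x else 0)" for i
          using False by (simp add: w_def \<phi>_def euclidean_inner[of _ "h x"])
        then show ?thesis using False j J by simp
      qed
      finally show ?thesis .
    qed
    have "P = {e \<in> X \<times> J. 0 \<le> (\<Sum>i\<in>I. w i * \<phi> i e)}"
      unfolding P using eq by auto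
    then show "P \<in> ?S" by blast
  qed
  show "finite ?F" using sub finS finite_subset by blast
  have "card ?F \<le> card ?S" using sub finS by (intro card_mono)
  also have "\<dots> \<le> card (X \<times> J) ^ card I + 1" using fin by (intro card_sign_patterns_le)
  also have "card I = DIM('b) * (card J - 1)"
    using J k by (simp add: I_def card_cartesian_product)
  finally show "card ?F \<le> (card X * card J) ^ (DIM('b) * (card J - 1)) + 1"
    by (simp add: card_cartesian_product)
qed

section \<open>A Chernoff bound for random assignments\<close>

text \<open>
  Hoeffding's lemma for a Bernoulli variable with parameter \<open>p\<close> at the negative argument \<open>- s\<close>;
  exchanging the two outcomes reduces it to the argument \<open>s\<close> and the parameter \<open>q = 1 - p\<close>.
\<close>
lemma hoeffding_bernoulli_lower:
  fixes p s :: real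
  assumes "0 \<le> s" "0 \<le> p" "p \<le> 1"
  shows "p * exp (- s) + (1 - p) \<le> exp (- s * p + s\<^sup>2 / 8)"
proof -
  define q where "q = 1 - p"
  have "1 + q * (exp s - 1) > 0"
    using assms by (intro add_pos_nonneg mult_nonneg_nonneg) (auto simp: q_def)
  moreover have "- s * q + ln (1 + q * (exp s - 1)) \<le> s\<^sup>2 / 8"
    using Hoeffdings_lemma_aux[of s q] assms by (simp add: q_def)
  ultimately have "1 + q * (exp s - 1) \<le> exp (s * q + s\<^sup>2 / 8)"
    by (subst ln_le_cancel_iff[symmetric]) auto
  then have "exp (- s) * (1 + q * (exp s - 1)) \<le> exp (- s) * exp (s * q + s\<^sup>2 / 8)"
    by (intro mult_left_mono) auto
  also have "\<dots> = exp (- s * p + s\<^sup>2 / 8)"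
    by (simp add: q_def algebra_simps flip: exp_add)
  also have "exp (- s) * (1 + q * (exp s - 1)) = p * exp (- s) + (1 - p)"
    by (simp add: q_def algebra_simps flip: exp_add)
  finally show ?thesis .
qed

text \<open>
  The exponential moment method, phrased as counting: give an assignment the weight
  \<open>exp (- s * hits)\<close>. The total weight is a product over \<open>X\<close>, and Hoeffding's lemma bounds each
  factor, while every assignment with few hits has a large weight. The inequality is strict
  because the assignment that hits everywhere has positive weight as well but is not counted.
\<close>
lemma few_assignments_with_few_hits:
  fixes P :: "('x \<times> 'j) set" and \<delta> :: real
  assumes X: "finite X" "X \<noteq> {}" and J: "finite J"
    and hit: "\<And>x. x \<in> X \<Longrightarrow> \<exists>j\<in>J. (x, j) \<in> P" and \<delta>: "\<delta> \<ge> 0"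
  shows "real (card {g \<in> X \<rightarrow>\<^sub>E J. real (card {x\<in>X. (x, g x) \<in> P})
                                    < real (card X) / real (card J) - \<delta>})
           < real (card J) ^ card X * exp (- 2 * \<delta>\<^sup>2 / real (card X))"
proof -
  define N where "N = real (card X)"
  define r where "r = real (card J)"
  have N: "N > 0" using X by (simp add: N_def card_gt_0_iff)
  have "J \<noteq> {}" using X hit by blast
  then have r: "r \<ge> 1" using J by (simp add: r_def Suc_le_eq card_gt_0_iff)
  \<comment> \<open>The minimiser of the exponent \<open>- s * \<delta> + N * s\<^sup>2 / 8\<close> of the final bound.\<close>
  define s where "s = 4 * \<delta> / N"
  have s: "s \<ge> 0" using \<delta> N by (simp add: s_def)
  define G where "G = X \<rightarrow>\<^sub>E J"
  define hits where "hits = (\<lambda>g. real (card {x\<in>X. (x, g x) \<in> P}))"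
  define B where "B = {g\<in>G. hits g < N / r - \<delta>}"
  define f where "f = (\<lambda>x j. if (x, j) \<in> P then exp (- s) else 1)"
  have finG: "finite G" using X J by (simp add: G_def finite_PiE)
  have weight: "(\<Prod>x\<in>X. f x (g x)) = exp (- s * hits g)" for g
  proof -
    have "(\<Prod>x\<in>X. f x (g x)) = (\<Prod>x | x \<in> X \<and> (x, g x) \<in> P. exp (- s))"
      unfolding f_def by (rule prod.inter_filter[OF X(1), symmetric])
    also have "\<dots> = exp (- s * hits g)"
      by (simp add: hits_def exp_of_nat_mult[symmetric] mult.commute)
    finally show ?thesis .
  qed
  have row: "(\<Sum>j\<in>J. f x j) \<le> r * exp (- s / r + s\<^sup>2 / 8)" if x: "x \<in> X" for x
  proof -
    obtain i where i: "i \<in> J" "(x, i) \<in> P" using hit x by blast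
    have "(\<Sum>j\<in>J. f x j) = exp (- s) + (\<Sum>j\<in>J - {i}. f x j)"
      using J i by (simp add: sum.remove[of J i] f_def)
    also have "\<dots> \<le> exp (- s) + (\<Sum>j\<in>J - {i}. 1)"
      using s by (intro add_left_mono sum_mono) (auto simp: f_def)
    also have "\<dots> = r * (1 / r * exp (- s) + (1 - 1 / r))"
    proof -
      have rest: "(\<Sum>j\<in>J - {i}. 1) = r - 1"
        using card.remove[OF J i(1)] by (simp add: r_def)
      show ?thesis unfolding rest using r by (simp add: distrib_left right_diff_distrib)
    qed
    also have "\<dots> \<le> r * exp (- s * (1 / r) + s\<^sup>2 / 8)"
      using r s by (intro mult_left_mono hoeffding_bernoulli_lower) auto
    finally show ?thesis by simp
  qed
  have "real (card B) * exp (- s * (N / r - \<delta>)) = (\<Sum>g\<in>B. exp (- s * (N / r - \<delta>)))"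
    by simp
  also have "\<dots> \<le> (\<Sum>g\<in>B. exp (- s * hits g))"
    using s by (intro sum_mono) (auto simp: B_def intro!: mult_left_mono)
  also have "\<dots> < (\<Sum>g\<in>G. exp (- s * hits g))"
  proof -
    obtain c where c: "\<And>x. x \<in> X \<Longrightarrow> c x \<in> J \<and> (x, c x) \<in> P" using hit by metis
    define g where "g = restrict c X"
    have gG: "g \<in> G" using c by (auto simp: g_def G_def)
    have "{x\<in>X. (x, g x) \<in> P} = X" using c by (auto simp: g_def)
    then have "hits g = N" by (simp add: hits_def N_def)
    moreover have "N / r \<le> N / 1" using N r by (intro divide_left_mono) auto
    ultimately have "g \<notin> B" using \<delta> by (simp add: B_def)
    then show ?thesis
      using finG gG by (intro sum_strict_mono2[of _ _ g]) (auto simp: B_def)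
  qed
  also have "\<dots> = (\<Prod>x\<in>X. \<Sum>j\<in>J. f x j)"
    unfolding G_def using X J by (simp add: prod_sum_PiE weight)
  also have "\<dots> \<le> (\<Prod>x\<in>X. r * exp (- s / r + s\<^sup>2 / 8))"
    using row by (intro prod_mono) (auto intro!: sum_nonneg simp: f_def)
  also have "\<dots> = r ^ card X * exp (N * (- s / r + s\<^sup>2 / 8))"
    by (simp add: power_mult_distrib N_def exp_of_nat_mult[symmetric])
  finally have "real (card B) * exp (- s * (N / r - \<delta>)) * exp (s * (N / r - \<delta>))
      < r ^ card X * exp (N * (- s / r + s\<^sup>2 / 8)) * exp (s * (N / r - \<delta>))"
    by (intro mult_strict_right_mono) auto
  then have "real (card B) < r ^ card X * exp (N * (- s / r + s\<^sup>2 / 8) + s * (N / r - \<delta>))"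
    by (simp add: mult.assoc flip: exp_add)
  also have "N * (- s / r + s\<^sup>2 / 8) + s * (N / r - \<delta>) = - 2 * \<delta>\<^sup>2 / N"
    using N r by (simp add: s_def field_simps power2_eq_square)
  finally show ?thesis by (simp add: B_def G_def hits_def N_def r_def)
qed

section \<open>Robust Tverberg partitions\<close>

theorem theorem3p1:
  fixes N d r :: nat and X :: "(real ^ 'd) set" and t :: int
  assumes "N > 0" and "r > 0" and "d = CARD('d)"
    and "card X = N"
    and "t = \<lceil>real N / real r
               - sqrt ((real d + 1) * (real r - 1) * real N * ln (real N * real r) / 2)\<rceil> - 1"
  shows "\<exists>A :: nat \<Rightarrow> (real ^ 'd) set.
           (\<Union>j\<in>{1..r}. A j) = X \<and> disjoint_family_on A {1..r} \<and>
           (\<forall>C :: (real ^ 'd) set. finite C \<and> int (card C) \<le> t \<longrightarrow>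
              (\<Inter>j\<in>{1..r}. convex hull (A j - C)) \<noteq> {})"
proof -
  define J where "J = {1..r}"
  define M where "M = N * r"
  define n where "n = (d + 1) * (r - 1)"
  define \<delta> where "\<delta> = sqrt (real n * real N * ln (real M) / 2)"
  have X: "finite X" "X \<noteq> {}" using assms by (auto intro: card_ge_0_finite)
  have J: "finite J" "J \<noteq> {}" "card J = r" using assms by (auto simp: J_def)
  have M: "M \<ge> 1" using assms by (simp add: M_def Suc_le_eq)
  then have lnM: "ln (real M) \<ge> 0" by simp
  have \<delta>: "\<delta> \<ge> 0" using lnM by (simp add: \<delta>_def)
  have "real (r - 1) = real r - 1" using assms(2) by (simp add: of_nat_diff)
  then have "real n = (real d + 1) * (real r - 1)"
    by (simp only: n_def of_nat_mult of_nat_add of_nat_1)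
  then have t: "real_of_int t < real N / real r - \<delta>"
    using assms(5) by (simp add: \<delta>_def M_def) linarith
  have "2 * \<delta>\<^sup>2 / real N = real n * ln (real M)"
    using lnM assms(1) by (simp add: \<delta>_def)
  then have exp_\<delta>: "exp (- 2 * \<delta>\<^sup>2 / real N) * real M ^ n = 1"
    using M by (simp add: exp_minus exp_of_nat_mult)
  define pat :: "(nat \<Rightarrow> (real ^ 'd) \<times> real) \<Rightarrow> ((real ^ 'd) \<times> nat) set"
    where "pat = (\<lambda>v. {(x, j) \<in> X \<times> J. 0 \<le> v j \<bullet> (x, 1)})"
  define F where "F = {pat v | v. (\<Sum>j\<in>J. v j) = 0}"
  define F' where "F' = F - {X \<times> J}"
  define G where "G = X \<rightarrow>\<^sub>E J"
  define B where "B = (\<lambda>P. {g \<in> G. real (card {x\<in>X. (x, g x) \<in> P}) < real N / real r - \<delta>})"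
  have finG: "finite G" using X J by (simp add: G_def finite_PiE)
  have finF: "finite F" and cardF: "card F \<le> M ^ n + 1"
    using card_zero_sum_patterns_le[OF X(1) J(1,2), of "\<lambda>x. (x, 1::real)"] J assms
    by (simp_all add: F_def pat_def M_def n_def)
  have "pat (\<lambda>_. 0) = X \<times> J" by (auto simp: pat_def)
  then have "X \<times> J \<in> F" unfolding F_def by (smt (verit) mem_Collect_eq sum.neutral)
  then have cardF': "card F' \<le> M ^ n" using cardF finF by (simp add: F'_def)
  have few: "real (card (B P)) < real r ^ N * exp (- 2 * \<delta>\<^sup>2 / real N)" if P: "P \<in> F" for P
  proof -
    obtain v where v: "P = pat v" "(\<Sum>j\<in>J. v j) = 0" using P unfolding F_def by blast
    have "\<exists>j\<in>J. (x, j) \<in> P" if x: "x \<in> X" for x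
    proof (rule ccontr)
      assume "\<not> ?thesis"
      then have "v j \<bullet> (x, 1) < 0" if "j \<in> J" for j using x that by (auto simp: v pat_def)
      then have "(\<Sum>j\<in>J. v j \<bullet> (x, 1)) < (\<Sum>j\<in>J. 0)" using J by (intro sum_strict_mono) auto
      then show False using v by (simp flip: inner_sum_left)
    qed
    from few_assignments_with_few_hits[OF X J(1) this \<delta>] show ?thesis
      using assms J by (simp add: B_def G_def)
  qed
  have "(\<Union>P\<in>F'. B P) \<noteq> G"
  proof (cases "F' = {}")
    case True
    moreover have "G \<noteq> {}" using J by (simp add: G_def PiE_eq_empty_iff)
    ultimately show ?thesis by simp
  next
    case False
    have "real (card (\<Union>P\<in>F'. B P)) \<le> (\<Sum>P\<in>F'. real (card (B P)))"
      using finF card_UN_le[of F' B] by (simp add: F'_def flip: of_nat_sum)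
    also have "\<dots> < (\<Sum>P\<in>F'. real r ^ N * exp (- 2 * \<delta>\<^sup>2 / real N))"
      using finF False few by (intro sum_strict_mono) (auto simp: F'_def)
    also have "\<dots> \<le> real (M ^ n) * (real r ^ N * exp (- 2 * \<delta>\<^sup>2 / real N))"
      using cardF' by (simp del: of_nat_power add: mult_right_mono)
    also have "\<dots> = real r ^ N * (exp (- 2 * \<delta>\<^sup>2 / real N) * real M ^ n)" by simp
    also have "\<dots> = real (card G)"
      unfolding exp_\<delta> using X J assms by (simp add: G_def card_PiE)
    finally show ?thesis by auto
  qed
  moreover have "(\<Union>P\<in>F'. B P) \<subseteq> G" by (auto simp: B_def)
  ultimately obtain g where g: "g \<in> G" "\<And>P. P \<in> F' \<Longrightarrow> g \<notin> B P" by blast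
  define A where "A = (\<lambda>j. {x\<in>X. g x = j})"
  have "(\<Inter>j\<in>J. convex hull (A j - C)) \<noteq> {}" if C: "finite C" "int (card C) \<le> t" for C
  proof
    assume "(\<Inter>j\<in>J. convex hull (A j - C)) = {}"
    moreover have "compact (convex hull (A j - C))" for j
      using X by (intro finite_imp_compact_convex_hull) (auto simp: A_def)
    ultimately obtain v :: "nat \<Rightarrow> (real ^ 'd) \<times> real" where v: "(\<Sum>j\<in>J. v j) = 0"
      "\<And>j x. j \<in> J \<Longrightarrow> x \<in> convex hull (A j - C) \<Longrightarrow> v j \<bullet> (x, 1) < 0"
      using disjoint_compact_convex_separation[OF J(1,2), of "\<lambda>j. convex hull (A j - C)"]
      by auto
    have "{x\<in>X. (x, g x) \<in> pat v} \<subseteq> C"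
    proof (rule ccontr)
      assume "\<not> ?thesis"
      then obtain x where x: "x \<in> X" "(x, g x) \<in> pat v" "x \<notin> C" by blast
      then have "x \<in> convex hull (A (g x) - C)" by (intro hull_inc) (simp add: A_def)
      moreover have "g x \<in> J" using g x by (auto simp: G_def)
      ultimately show False using v(2) x by (fastforce simp: pat_def)
    qed
    then have "card {x\<in>X. (x, g x) \<in> pat v} \<le> card C" using C by (intro card_mono)
    then have less: "real (card {x\<in>X. (x, g x) \<in> pat v}) < real N / real r - \<delta>"
      using C t by linarith
    show False
    proof (cases "pat v = X \<times> J")
      case True
      have "{x\<in>X. (x, g x) \<in> pat v} = X" using g by (auto simp: True G_def)
      moreover have "real N / real r \<le> real N" using assms by (simp add: divide_le_eq)
      ultimately show False using less \<delta> assms by simp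
    next
      case False
      then have "pat v \<in> F'" using v by (auto simp: F'_def F_def)
      then show False using g less by (auto simp: B_def)
    qed
  qed
  moreover have "(\<Union>j\<in>J. A j) = X" using g by (auto simp: A_def G_def)
  moreover have "disjoint_family_on A J" by (auto simp: disjoint_family_on_def A_def)
  ultimately show ?thesis unfolding J_def by blast
qed

end
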